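(* Let $(S_O,P_O)$ be a deductive source with (nonempty) reconstruction alphabet $\hat S_O$. For every integer $\delta\ge 0$ and every $D\ge 0$, $$R_{\mathrm{sem}}(D,\delta;d_{\mathrm{Cn}}^{\delta},P_O)=P_\delta\cdot R^{(A_\delta)}\Bigl(\frac{D}{P_\delta};d_{\mathrm{Cn}}^{\delta},\pi_\delta\Bigr),$$ with the convention that the right-hand side is $0$ when $P_\delta=0$. In particular, at $\delta=0$ one has $A_0=S_O$, $d_{\mathrm{Cn}}^{0}=d_H$ where $d_H(s,\hat s)=\mathbf 1[s\neq\hat s]$, and $$R_{\mathrm{sem}}(D,0;d_{\mathrm{Cn}}^{0},P_O)=\min_{P_{\hat S\mid S}:\ \mathbb{E}[d_H(\mathsf S_o,\hat{\mathsf S}_o)]\le D} I(\mathsf S_o;\hat{\mathsf S}_o),$$ the minimum being over test channels from $S_O$ to $\hat S_O$ with $\mathsf S_o\sim P_O$.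
   Context: Setting. $\mathbb{S}_O$ is a finite set of statements with a fixed proof system with decidable derivability; $\mathrm{Cn}(\Gamma)\subseteq\mathbb{S}_O$ is the set of statements derivable from $\Gamma\subseteq\mathbb{S}_O$; $\mathrm{Cn}$ is reflexive, monotone and idempotent. $S_O\subseteq\mathbb{S}_O$ is a finite knowledge base, $\hat S_O\subseteq\mathbb{S}_O$ a nonempty finite reconstruction alphabet, and a deductive source is a pair $(S_O,P_O)$ with $P_O$ a probability distribution on $S_O$. Finite-step closure. There is a computable operator $T=T_{\mathsf{PS}}$ on finite subsets of $\mathbb{S}_O$ with: $T(B)\supseteq B$; $B\subseteq B'\Rightarrow T(B)\subseteq T(B')$; with $T^0(B)=B$, $T^{n+1}(B)=T(T^n(B))$ one has $\mathrm{Cn}(B)=\bigcup_{n\ge0}T^n(B)$; and the sequence $T^n(B)$ stabilizes after finitely many iterations. $\delta$-step closure distortion. For an integer $\delta\ge0$, $s\in S_O$, $\hat s\in\hat S_O$: $d_{\mathrm{Cn}}^{\delta}(s,\hat s)=d_{\mathrm{Cn}}^{\delta}(s,\hat s\mid S_O)=0$ if $S_O\subseteq T^\delta((S_O\setminus\{s\})\cup\{\hat s\})$, and $=1$ otherwise. $\delta$-irredundant core. $A_\delta=\{s\in S_O: s\notin T^\delta(S_O\setminus\{s\})\}$, $P_\delta=P_O(A_\delta)$, and, if $P_\delta>0$, $\pi_\delta(s)=P_O(s)/P_\delta$ for $s\in A_\delta$. Rate functions. $R_{\mathrm{sem}}(D,\delta;d_{\mathrm{Cn}}^{\delta},P_O)$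 is the minimum of the mutual information $I(\mathsf S_o;\hat{\mathsf S}_o)$ over test channels $P_{\hat S\mid S}$ from $S_O$ to $\hat S_O$ with $\mathbb{E}[d_{\mathrm{Cn}}^{\delta}(\mathsf S_o,\hat{\mathsf S}_o)]\le D$, where $\mathsf S_o\sim P_O$. For $P_\delta>0$, $R^{(A_\delta)}(D';d_{\mathrm{Cn}}^{\delta},\pi_\delta)$ is the minimum of $I(\mathsf A_{\delta,o};\hat{\mathsf S}_o)$ over test channels from $A_\delta$ to $\hat S_O$ with $\mathbb{E}[d_{\mathrm{Cn}}^{\delta}(\mathsf A_{\delta,o},\hat{\mathsf S}_o\mid S_O)]\le D'$, where $\mathsf A_{\delta,o}\sim\pi_\delta$. Minima over empty constraint sets are $+\infty$. *)

theory Defs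
  imports "HOL-Probability.Probability"
begin

text \<open>
  The finite set of all statements is the universe of a type \<open>'s\<close> of class \<open>finite\<close>.
  All subsets of it are then finite, and every operator on them is computable.
\<close>

definition Cn :: "('s set \<Rightarrow> 's \<Rightarrow> bool) \<Rightarrow> 's set \<Rightarrow> 's set" where
  "Cn derives \<Gamma> = {s. derives \<Gamma> s}"

locale finite_step_closure =
  fixes derives :: "'s::finite set \<Rightarrow> 's \<Rightarrow> bool"
    and T :: "'s set \<Rightarrow> 's set"
  assumes Cn_reflexive: "\<Gamma> \<subseteq> Cn derives \<Gamma>"
    and Cn_monotone: "\<Gamma> \<subseteq> \<Gamma>' \<Longrightarrow> Cn derives \<Gamma> \<subseteq> Cn derives \<Gamma>'"
    and Cn_idempotent: "Cn derives (Cn derives \<Gamma>) = Cn derives \<Gamma>"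
    and T_extensive: "B \<subseteq> T B"
    and T_monotone: "B \<subseteq> B' \<Longrightarrow> T B \<subseteq> T B'"
    and Cn_eq_UN_T: "Cn derives B = (\<Union>n. (T ^^ n) B)"
    and T_stabilizes: "\<exists>N. \<forall>n\<ge>N. (T ^^ n) B = (T ^^ N) B"

locale deductive_source = finite_step_closure derives T
  for derives :: "'s::finite set \<Rightarrow> 's \<Rightarrow> bool" and T :: "'s set \<Rightarrow> 's set" +
  fixes S :: "'s set"
    and Sh :: "'s set"  \<comment> \<open>reconstruction alphabet\<close>
    and P :: "'s pmf"
  assumes P_supported: "set_pmf P \<subseteq> S"
    and Sh_nonempty: "Sh \<noteq> {}"

definition closure_distortion ::
    "('s set \<Rightarrow> 's set) \<Rightarrow> 's set \<Rightarrow> nat \<Rightarrow> 's \<Rightarrow> 's \<Rightarrow> real" where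
  "closure_distortion T S \<delta> s t = (if S \<subseteq> (T ^^ \<delta>) ((S - {s}) \<union> {t}) then 0 else 1)"

definition hamming_distortion :: "'s \<Rightarrow> 's \<Rightarrow> real" where
  "hamming_distortion s t = (if s \<noteq> t then 1 else 0)"

definition core :: "('s set \<Rightarrow> 's set) \<Rightarrow> 's set \<Rightarrow> nat \<Rightarrow> 's set" where
  "core T S \<delta> = {s \<in> S. s \<notin> (T ^^ \<delta>) (S - {s})}"

definition core_prob :: "('s set \<Rightarrow> 's set) \<Rightarrow> 's set \<Rightarrow> 's pmf \<Rightarrow> nat \<Rightarrow> real" where
  "core_prob T S P \<delta> = measure_pmf.prob P (core T S \<delta>)"

text \<open>Unspecified if \<open>core_prob T S P \<delta> = 0\<close>.\<close>

definition core_pmf :: "('s set \<Rightarrow> 's set) \<Rightarrow> 's set \<Rightarrow> 's pmf \<Rightarrow> nat \<Rightarrow> 's pmf" where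
  "core_pmf T S P \<delta> = cond_pmf P (core T S \<delta>)"

text \<open>
  A test channel from \<open>A\<close> to \<open>Sh\<close> is a kernel; its values outside \<open>A\<close> are irrelevant, because
  it is only ever composed with input distributions supported on \<open>A\<close>.
\<close>

definition test_channels :: "'s set \<Rightarrow> 's set \<Rightarrow> ('s \<Rightarrow> 's pmf) set" where
  "test_channels A Sh = {W. \<forall>s\<in>A. set_pmf (W s) \<subseteq> Sh}"

definition joint_pmf :: "'s pmf \<Rightarrow> ('s \<Rightarrow> 's pmf) \<Rightarrow> ('s \<times> 's) pmf" where
  "joint_pmf p W = bind_pmf p (\<lambda>s. map_pmf (\<lambda>t. (s, t)) (W s))"

definition expected_distortion ::
    "('s \<Rightarrow> 's \<Rightarrow> real) \<Rightarrow> 's pmf \<Rightarrow> ('s \<Rightarrow> 's pmf) \<Rightarrow> real" where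
  "expected_distortion d p W = measure_pmf.expectation (joint_pmf p W) (\<lambda>(s, t). d s t)"

text \<open>Mutual information between input and output, with logarithms to base \<open>b\<close>.\<close>

definition channel_information :: "real \<Rightarrow> 's pmf \<Rightarrow> ('s \<Rightarrow> 's pmf) \<Rightarrow> real" where
  "channel_information b p W =
     prob_space.mutual_information (measure_pmf (joint_pmf p W)) b
       (count_space UNIV) (count_space UNIV) fst snd"

definition feasible_channels ::
    "'s set \<Rightarrow> 's set \<Rightarrow> 's pmf \<Rightarrow> ('s \<Rightarrow> 's \<Rightarrow> real) \<Rightarrow> real \<Rightarrow> ('s \<Rightarrow> 's pmf) set" where
  "feasible_channels A Sh p d D = {W \<in> test_channels A Sh. expected_distortion d p W \<le> D}"

text \<open>
  \<open>LEAST\<close> is a genuine minimum: over a finite alphabet the feasible channels form a compact set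
  (up to their irrelevant values), on which the mutual information is continuous.
\<close>

definition rate_function ::
    "real \<Rightarrow> 's set \<Rightarrow> 's set \<Rightarrow> 's pmf \<Rightarrow> ('s \<Rightarrow> 's \<Rightarrow> real) \<Rightarrow> real \<Rightarrow> ereal" where
  "rate_function b A Sh p d D =
     (if feasible_channels A Sh p d D = {} then \<infinity>
      else (LEAST r. r \<in> (\<lambda>W. ereal (channel_information b p W)) ` feasible_channels A Sh p d D))"

definition R_sem ::
    "real \<Rightarrow> ('s set \<Rightarrow> 's set) \<Rightarrow> 's set \<Rightarrow> 's set \<Rightarrow> 's pmf \<Rightarrow> real \<Rightarrow> nat \<Rightarrow> ereal" where
  "R_sem b T S Sh P D \<delta> = rate_function b S Sh P (closure_distortion T S \<delta>) D"

text \<open>The distortion on the core is still taken relative to the full knowledge base \<open>S\<close>.\<close>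

definition R_core ::
    "real \<Rightarrow> ('s set \<Rightarrow> 's set) \<Rightarrow> 's set \<Rightarrow> 's set \<Rightarrow> 's pmf \<Rightarrow> real \<Rightarrow> nat \<Rightarrow> ereal" where
  "R_core b T S Sh P D' \<delta> =
     rate_function b (core T S \<delta>) Sh (core_pmf T S P \<delta>) (closure_distortion T S \<delta>) D'"

end

(*
  Write I(p, W) = sum_s p(s) KL(W(s) || q), with q the output law. Inputs outside the core have
  distortion 0 whatever is reproduced. Dropping their (nonnegative) terms and replacing q by the
  output law of the core only decreases the sum, which gives the lower bound P_delta I(pi_delta, W).
  Conversely, letting every redundant input emit the output law of a core channel attains this bound.
  The minimum over core channels exists by compactness, so that the LEAST in the rate function is
  meaningful.
*)
theory Submission imports Defs "HOL-Real_Asymp.Real_Asymp" begin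

section \<open>Distortion and information of a finite channel as sums\<close>

text \<open>Terms with \<open>pmf q t = 0 < pmf p t\<close> count as \<open>0\<close> instead of \<open>\<infinity>\<close>, hence the
  absolute continuity assumptions below.\<close>
definition relative_entropy :: "real \<Rightarrow> 's::finite pmf \<Rightarrow> 's pmf \<Rightarrow> real" where
  "relative_entropy b p q = (\<Sum>t\<in>UNIV. pmf p t * log b (pmf p t / pmf q t))"

lemma sum_pmf_UNIV: "(\<Sum>t\<in>UNIV. pmf (p :: 's::finite pmf) t) = 1"
  by (rule sum_pmf_eq_1) auto

lemma pmf_bind_finite:
  fixes p :: "'s::finite pmf"
  shows "pmf (bind_pmf p W) t = (\<Sum>s\<in>UNIV. pmf p s * pmf (W s) t)"
  unfolding pmf_bind by (subst integral_measure_pmf[of UNIV]) auto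

lemma pmf_joint:
  fixes p :: "'s::finite pmf"
  shows "pmf (joint_pmf p W) (s, t) = pmf p s * pmf (W s) t"
proof -
  have "pmf (map_pmf (Pair r) (W r)) (s, t) = (if r = s then pmf (W s) t else 0)" for r
    using pmf_map_inj'[of "Pair s" "W s" t]
    by (auto simp: inj_on_def intro!: pmf_map_outside)
  then show ?thesis
    by (simp add: joint_pmf_def pmf_bind_finite if_distrib[where f = "(*) _"] cong: if_cong)
qed

lemma expected_distortion_eq_sum:
  fixes p :: "'s::finite pmf"
  shows "expected_distortion d p W = (\<Sum>s\<in>UNIV. pmf p s * (\<Sum>t\<in>UNIV. pmf (W s) t * d s t))"
proof -
  have "expected_distortion d p W = (\<Sum>x\<in>UNIV. pmf (joint_pmf p W) x * (case x of (s, t) \<Rightarrow> d s t))"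
    unfolding expected_distortion_def by (subst integral_measure_pmf[of UNIV]) auto
  also have "\<dots> = (\<Sum>s\<in>UNIV. \<Sum>t\<in>UNIV. pmf p s * pmf (W s) t * d s t)"
    by (simp add: UNIV_Times_UNIV[symmetric] sum.cartesian_product case_prod_unfold
        pmf_joint[symmetric] del: UNIV_Times_UNIV)
  finally show ?thesis
    by (simp add: sum_distrib_left mult.assoc)
qed

text \<open>Written as an average over inputs of divergences from the output law, the information
  can be compared input by input. On a finite alphabet mass functions serve as densities against
  counting measure.\<close>

lemma channel_information_eq_sum:
  fixes p :: "'s::finite pmf"
  assumes b: "1 < b"
  shows "channel_information b p W = (\<Sum>s\<in>UNIV. pmf p s * relative_entropy b (W s) (bind_pmf p W))"
proof -
  define q where "q = bind_pmf p W"
  define J where "J = joint_pmf p W"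
  interpret information_space "measure_pmf J" b
    by standard (fact b)
  have fst: "map_pmf fst J = p" and snd: "map_pmf snd J = q"
    by (simp_all add: J_def q_def joint_pmf_def map_bind_pmf pmf.map_comp o_def
        map_pmf_const bind_return_pmf')
  have D1: "distributed (measure_pmf J) (count_space UNIV) fst (pmf p)"
    unfolding distributed_def fst[symmetric]
    by (simp add: map_pmf_rep_eq[symmetric] measure_pmf_eq_density[symmetric])
  have D2: "distributed (measure_pmf J) (count_space UNIV) snd (pmf q)"
    unfolding distributed_def snd[symmetric]
    by (simp add: map_pmf_rep_eq[symmetric] measure_pmf_eq_density[symmetric])
  have CS: "count_space UNIV \<Otimes>\<^sub>M count_space UNIV = (count_space UNIV :: ('s \<times> 's) measure)"
    by (subst pair_measure_count_space) auto
  \<comment> \<open>Pairing \<open>fst\<close> with \<open>snd\<close> is the identity, so the image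
    measure is \<open>J\<close> itself.\<close>
  have D3: "distributed (measure_pmf J) (count_space UNIV \<Otimes>\<^sub>M count_space UNIV)
      (\<lambda>x. (fst x, snd x)) (pmf J)"
    unfolding distributed_def CS
    by (simp add: measure_pmf_eq_density[symmetric])
      (simp add: map_pmf_rep_eq[symmetric] map_pmf_id flip: id_def)
  have "channel_information b p W =
      (\<integral>x. pmf J x * log b (pmf J x / (pmf p (fst x) * pmf q (snd x)))
        \<partial>(count_space UNIV \<Otimes>\<^sub>M count_space UNIV))"
    unfolding channel_information_def J_def[symmetric]
    by (subst mutual_information_distr[OF sigma_finite_measure_count_space_finite
          sigma_finite_measure_count_space_finite D1 _ D2 _ D3])
       (auto simp: case_prod_unfold)
  also have "\<dots> = (\<Sum>x\<in>UNIV. pmf J x * log b (pmf J x / (pmf p (fst x) * pmf q (snd x))))"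
    unfolding CS by (simp add: lebesgue_integral_count_space_finite)
  also have "\<dots> = (\<Sum>s\<in>UNIV. \<Sum>t\<in>UNIV. pmf J (s, t) * log b (pmf J (s, t) / (pmf p s * pmf q t)))"
    by (simp add: UNIV_Times_UNIV[symmetric] sum.cartesian_product case_prod_unfold
        del: UNIV_Times_UNIV)
  \<comment> \<open>The factor \<open>pmf p s\<close> cancels in the quotient; where it is zero,
    both terms vanish.\<close>
  also have "\<dots> = (\<Sum>s\<in>UNIV. pmf p s * relative_entropy b (W s) q)"
    unfolding relative_entropy_def sum_distrib_left J_def pmf_joint
    by (intro sum.cong refl) auto
  finally show ?thesis unfolding q_def .
qed

section \<open>Gibbs' inequality and the compensation identity\<close>

text \<open>The bound \<open>ln x \<le> x - 1\<close> at \<open>x = pmf q t / pmf p t\<close> puts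
  \<open>(pmf p t - pmf q t) / ln b\<close> below each summand, and these lower bounds sum to zero
  because both laws have total mass one.\<close>

lemma relative_entropy_nonneg:
  fixes p q :: "'s::finite pmf"
  assumes b: "1 < b" and ac: "set_pmf p \<subseteq> set_pmf q"
  shows "0 \<le> relative_entropy b p q"
proof -
  have "(pmf p t - pmf q t) / ln b \<le> pmf p t * log b (pmf p t / pmf q t)" for t
  proof (cases "t \<in> set_pmf p")
    case True
    then have pos: "0 < pmf p t" "0 < pmf q t"
      using ac by (auto simp: pmf_positive_iff)
    then have "1 - pmf q t / pmf p t \<le> ln (pmf p t / pmf q t)"
      using ln_le_minus_one[of "pmf q t / pmf p t"] by (simp add: ln_div)
    then have "pmf p t * (1 - pmf q t / pmf p t) \<le> pmf p t * ln (pmf p t / pmf q t)"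
      using pos by (intro mult_left_mono) auto
    then show ?thesis
      using pos b by (simp add: log_def divide_right_mono right_diff_distrib)
  next
    case False
    then show ?thesis
      using b by (simp add: set_pmf_iff)
  qed
  then have "(\<Sum>t\<in>UNIV. (pmf p t - pmf q t) / ln b) \<le> relative_entropy b p q"
    unfolding relative_entropy_def by (rule sum_mono)
  then show ?thesis
    by (simp add: sum_divide_distrib[symmetric] sum_subtractf sum_pmf_UNIV)
qed

lemma relative_entropy_self [simp]: "relative_entropy b p p = 0"
  unfolding relative_entropy_def by (rule sum.neutral) (auto simp: log_def)

text \<open>Compensation identity: measuring divergence from a reference law \<open>q\<close>
  instead of the true output law costs exactly the divergence between these two. It later compares
  the output laws of a source and of its restriction to a subset.\<close>

lemma sum_relative_entropy_eq:
  fixes p q :: "'s::finite pmf"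
  assumes b: "1 < b" and ac: "set_pmf (bind_pmf p W) \<subseteq> set_pmf q"
  shows "(\<Sum>s\<in>UNIV. pmf p s * relative_entropy b (W s) q) =
    channel_information b p W + relative_entropy b (bind_pmf p W) q"
proof -
  let ?r = "bind_pmf p W"
  \<comment> \<open>The logarithm splits where all three probabilities are positive, which absolute
    continuity ensures on the support; elsewhere a zero prefactor kills both sides.\<close>
  have eq: "pmf p s * (pmf (W s) t * log b (pmf (W s) t / pmf q t)) =
      pmf p s * (pmf (W s) t * log b (pmf (W s) t / pmf ?r t)) +
      pmf p s * pmf (W s) t * log b (pmf ?r t / pmf q t)" for s t
  proof (cases "s \<in> set_pmf p \<and> t \<in> set_pmf (W s)")
    case True
    then have "t \<in> set_pmf ?r" by auto
    with True ac have "0 < pmf (W s) t" "0 < pmf ?r t" "0 < pmf q t"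
      unfolding pmf_positive_iff by blast+
    with b show ?thesis
      by (simp add: log_divide algebra_simps)
  qed (auto simp: set_pmf_iff)
  have "(\<Sum>s\<in>UNIV. pmf p s * relative_entropy b (W s) q) = channel_information b p W +
      (\<Sum>s\<in>UNIV. \<Sum>t\<in>UNIV. pmf p s * pmf (W s) t * log b (pmf ?r t / pmf q t))"
    unfolding channel_information_eq_sum[OF b] relative_entropy_def sum_distrib_left eq sum.distrib ..
  also have "(\<Sum>s\<in>UNIV. \<Sum>t\<in>UNIV. pmf p s * pmf (W s) t * log b (pmf ?r t / pmf q t)) =
      relative_entropy b ?r q"
    unfolding relative_entropy_def pmf_bind_finite[of p W]
    by (subst sum.swap) (simp add: sum_distrib_right)
  finally show ?thesis .
qed

lemma channel_information_nonneg:
  fixes p :: "'s::finite pmf"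
  assumes "1 < b"
  shows "0 \<le> channel_information b p W"
  unfolding channel_information_eq_sum[OF assms]
proof (rule sum_nonneg)
  fix s show "0 \<le> pmf p s * relative_entropy b (W s) (bind_pmf p W)"
  proof (cases "s \<in> set_pmf p")
    case True
    then show ?thesis
      using assms by (intro mult_nonneg_nonneg relative_entropy_nonneg) auto
  qed (simp add: set_pmf_iff)
qed

section \<open>Continuity of the information and existence of minimizers\<close>

text \<open>Only the point 0 is delicate: there the default value of the logarithm is multiplied by
  0, which agrees with the limit of \<open>x * ln x\<close>. As \<open>b\<close> is arbitrary,
  \<open>ln b = 0\<close> is treated apart; division by zero then makes \<open>log b\<close> vanish
  identically.\<close>

lemma continuous_on_xlogx: "continuous_on {0..} (\<lambda>x::real. x * log b x)"
  unfolding continuous_on_def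
proof
  fix x :: real assume "x \<in> {0..}"
  then consider "x = 0" | "0 < x" by force
  then show "((\<lambda>x. x * log b x) \<longlongrightarrow> x * log b x) (at x within {0..})"
  proof cases
    case 1
    have "((\<lambda>x::real. x * ln x) \<longlongrightarrow> 0) (at_right 0)"
      by real_asymp
    from tendsto_divide[OF this tendsto_const, of "ln b"] show ?thesis
      using 1 by (cases "ln b = 0") (auto simp: at_within_Ici_at_right log_def)
  next
    case 2
    have "((\<lambda>x. x * ln x / ln b) \<longlongrightarrow> x * ln x / ln b) (at x within {0..})"
      using 2 by (cases "ln b = 0") (auto intro!: tendsto_intros)
    then show ?thesis by (simp add: log_def)
  qed
qed

text \<open>In this form, the information is visibly continuous in the transition probabilities.\<close>
lemma channel_information_eq_entropies:
  fixes p :: "'s::finite pmf"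
  assumes b: "1 < b"
  shows "channel_information b p W =
    (\<Sum>s\<in>UNIV. pmf p s * (\<Sum>t\<in>UNIV. pmf (W s) t * log b (pmf (W s) t))) -
    (\<Sum>t\<in>UNIV. pmf (bind_pmf p W) t * log b (pmf (bind_pmf p W) t))"
proof -
  let ?r = "bind_pmf p W"
  have eq: "pmf p s * (pmf (W s) t * log b (pmf (W s) t / pmf ?r t)) =
      pmf p s * (pmf (W s) t * log b (pmf (W s) t)) -
      pmf p s * pmf (W s) t * log b (pmf ?r t)" for s t
  proof (cases "s \<in> set_pmf p \<and> t \<in> set_pmf (W s)")
    case True
    then have "t \<in> set_pmf ?r" by auto
    with True have "0 < pmf (W s) t" "0 < pmf ?r t"
      unfolding pmf_positive_iff by blast+
    with b show ?thesis
      by (simp add: log_divide algebra_simps)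
  qed (auto simp: set_pmf_iff)
  have "(\<Sum>s\<in>UNIV. \<Sum>t\<in>UNIV. pmf p s * pmf (W s) t * log b (pmf ?r t)) =
      (\<Sum>t\<in>UNIV. pmf ?r t * log b (pmf ?r t))"
    unfolding pmf_bind_finite[of p W]
    by (subst sum.swap) (simp add: sum_distrib_right)
  then show ?thesis
    unfolding channel_information_eq_sum[OF b] relative_entropy_def sum_distrib_left eq sum_subtractf
    by simp
qed


text \<open>Extreme value theorem on the nonempty compact set of transition matrices of feasible
  channels.\<close>

lemma exists_information_minimizer:
  fixes p :: "'s::finite pmf"
  assumes b: "1 < b" and ne: "feasible_channels A Sh p d D \<noteq> {}"
  shows "\<exists>W\<in>feasible_channels A Sh p d D. \<forall>V\<in>feasible_channels A Sh p d D.
    channel_information b p W \<le> channel_information b p V"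
proof -
  define mat :: "('s \<Rightarrow> 's pmf) \<Rightarrow> real ^ 's ^ 's" where "mat W = (\<chi> s t. pmf (W s) t)" for W
  define H :: "real \<Rightarrow> real" where "H x = x * log b x" for x
  define info :: "real ^ 's ^ 's \<Rightarrow> real" where
    "info v = (\<Sum>s\<in>UNIV. pmf p s * (\<Sum>t\<in>UNIV. H (v $ s $ t))) -
      (\<Sum>t\<in>UNIV. H (\<Sum>s\<in>UNIV. pmf p s * v $ s $ t))" for v
  \<comment> \<open>Rows outside \<open>A\<close> are kept stochastic as well, so that the set stays
    bounded; the support condition binds only the rows in \<open>A\<close>.\<close>
  define K where "K = {v. (\<forall>s t. 0 \<le> v $ s $ t) \<and> (\<forall>s. (\<Sum>t\<in>UNIV. v $ s $ t) = 1) \<and>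
    (\<forall>s\<in>A. \<forall>t. t \<notin> Sh \<longrightarrow> v $ s $ t = 0) \<and>
    (\<Sum>s\<in>UNIV. pmf p s * (\<Sum>t\<in>UNIV. v $ s $ t * d s t)) \<le> D}"
  have K: "K = mat ` feasible_channels A Sh p d D"
  proof (intro equalityI subsetI)
    fix v assume v: "v \<in> K"
    define W where "W s = embed_pmf (\<lambda>t. v $ s $ t)" for s
    have W: "pmf (W s) t = v $ s $ t" for s t
      unfolding W_def
    proof (rule pmf_embed_pmf)
      show "0 \<le> v $ s $ t" for t using v by (simp add: K_def)
      then show "(\<integral>\<^sup>+ t. ennreal (v $ s $ t) \<partial>count_space UNIV) = 1"
        using v by (simp add: nn_integral_count_space_finite sum_ennreal K_def)
    qed
    then have "W \<in> feasible_channels A Sh p d D"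
      using v unfolding feasible_channels_def test_channels_def expected_distortion_eq_sum
        K_def subset_iff set_pmf_iff mem_Collect_eq by (metis (no_types, lifting) sum.cong)
    moreover have "v = mat W"
      by (simp add: mat_def W vec_eq_iff)
    ultimately show "v \<in> mat ` feasible_channels A Sh p d D" by blast
  next
    fix v assume "v \<in> mat ` feasible_channels A Sh p d D"
    then show "v \<in> K"
      by (auto simp: mat_def K_def feasible_channels_def test_channels_def
          expected_distortion_eq_sum sum_pmf_UNIV pmf_eq_0_set_pmf) blast
  qed
  have info: "info (mat W) = channel_information b p W" for W
    unfolding info_def H_def mat_def channel_information_eq_entropies[OF b] pmf_bind_finite
    by simp
  have "compact K"
  proof (rule compact_eq_bounded_closed[THEN iffD2], rule conjI)
    \<comment> \<open>All entries are at most 1, so a crude bound over rows and columns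
      suffices.\<close>
    have "norm (mat W) \<le> of_nat CARD('s) * of_nat CARD('s)" for W
    proof -
      have "norm (mat W) \<le> (\<Sum>s\<in>UNIV. norm (mat W $ s))"
        unfolding norm_vec_def by (rule L2_set_le_sum) simp
      also have "\<dots> \<le> (\<Sum>s\<in>(UNIV :: 's set). of_nat CARD('s))"
      proof (rule sum_mono)
        fix s
        have "norm (mat W $ s) \<le> (\<Sum>t\<in>UNIV. \<bar>mat W $ s $ t\<bar>)"
          by (rule norm_le_l1_cart)
        also have "\<dots> \<le> of_nat CARD('s)"
          using sum_mono[of UNIV "\<lambda>t. \<bar>mat W $ s $ t\<bar>" "\<lambda>_. 1"] by (simp add: mat_def pmf_le_1)
        finally show "norm (mat W $ s) \<le> of_nat CARD('s)" .
      qed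
      finally show ?thesis by simp
    qed
    then show "bounded K" unfolding K bounded_iff by blast
    show "closed K"
      unfolding K_def Ball_def
      by (intro closed_Collect_conj closed_Collect_all closed_Collect_imp closed_Collect_le
          closed_Collect_eq open_Collect_const continuous_intros)
  qed
  moreover have "K \<noteq> {}"
    using ne by (simp add: K)
  moreover have "continuous_on K info"
    unfolding info_def H_def
  proof (intro continuous_on_diff continuous_on_sum continuous_on_mult_left)
    note H = continuous_on_compose2[OF continuous_on_xlogx]
    show "continuous_on K (\<lambda>v. v $ s $ t * log b (v $ s $ t))" for s t
      by (rule H) (auto simp: K_def intro!: continuous_intros)
    show "continuous_on K (\<lambda>v. (\<Sum>s\<in>UNIV. pmf p s * v $ s $ t) *
        log b (\<Sum>s\<in>UNIV. pmf p s * v $ s $ t))" for t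
      by (rule H) (auto simp: K_def intro!: continuous_intros sum_nonneg)
  qed
  ultimately have "\<exists>v\<in>K. \<forall>w\<in>K. info v \<le> info w"
    by (rule continuous_attains_inf)
  then show ?thesis
    by (simp add: K info)
qed

section \<open>Evaluating and comparing rate functions\<close>

lemma rate_function_eqI:
  assumes "W \<in> feasible_channels A Sh p d D"
    and "\<And>V. V \<in> feasible_channels A Sh p d D \<Longrightarrow> r \<le> channel_information b p V"
    and "channel_information b p W = r"
  shows "rate_function b A Sh p d D = ereal r"
  unfolding rate_function_def using assms by (auto intro!: Least_equality)

text \<open>Inputs of probability zero do not enter the expectation. This matters for
  \<open>closure_distortion\<close> and \<open>hamming_distortion\<close>, whose agreement at zero
  steps is available only for inputs in the knowledge base.\<close>

lemma rate_function_cong: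
  fixes p :: "'s::finite pmf"
  assumes "\<And>s t. s \<in> set_pmf p \<Longrightarrow> d s t = d' s t"
  shows "rate_function b A Sh p d D = rate_function b A Sh p d' D"
proof -
  have "pmf p s * (\<Sum>t\<in>UNIV. pmf (W s) t * d s t) = pmf p s * (\<Sum>t\<in>UNIV. pmf (W s) t * d' s t)"
    for s and W :: "'s \<Rightarrow> 's pmf"
    using assms[of s] by (cases "s \<in> set_pmf p") (simp_all add: set_pmf_iff)
  then have "expected_distortion d p = expected_distortion d' p"
    unfolding expected_distortion_eq_sum[abs_def] by presburger
  then have "feasible_channels A Sh p d D = feasible_channels A Sh p d' D"
    by (simp add: feasible_channels_def)
  then show ?thesis
    by (simp only: rate_function_def)
qed

section \<open>Conditioning a source on an input set of positive probability\<close>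

context
  fixes p :: "'s::finite pmf" and A :: "'s set" and Q :: real
  defines "Q \<equiv> measure_pmf.prob p A"
  assumes Q_pos: "0 < Q"
begin

lemma pmf_cond_eq: "pmf (cond_pmf p A) s = (if s \<in> A then pmf p s / Q else 0)"
proof -
  have "set_pmf p \<inter> A \<noteq> {}"
    using Q_pos unfolding Q_def by (metis less_irrefl measure_pmf_zero_iff)
  then show ?thesis unfolding Q_def by (rule pmf_cond)
qed

text \<open>The factor \<open>Q\<close> cancels the normalization of the conditional law.
  Distortions, informations and output laws are compared through this identity.\<close>

lemma sum_cond_pmf:
  "Q * (\<Sum>s\<in>UNIV. pmf (cond_pmf p A) s * f s) = (\<Sum>s\<in>A. pmf p s * f s)"
proof -
  have "Q * (\<Sum>s\<in>UNIV. pmf (cond_pmf p A) s * f s) = (\<Sum>s\<in>UNIV. if s \<in> A then pmf p s * f s else 0)"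
    unfolding sum_distrib_left by (intro sum.cong) (use Q_pos in \<open>auto simp: pmf_cond_eq\<close>)
  then show ?thesis by (simp add: sum.If_cases)
qed

lemma expected_distortion_cond_pmf:
  assumes "\<And>s t. s \<in> set_pmf p \<Longrightarrow> s \<notin> A \<Longrightarrow> d s t = 0"
  shows "expected_distortion d p W = Q * expected_distortion d (cond_pmf p A) W"
  unfolding expected_distortion_eq_sum sum_cond_pmf
proof (rule sum.mono_neutral_right)
  show "\<forall>s\<in>UNIV - A. pmf p s * (\<Sum>t\<in>UNIV. pmf (W s) t * d s t) = 0"
  proof
    fix s assume "s \<in> UNIV - A"
    then show "pmf p s * (\<Sum>t\<in>UNIV. pmf (W s) t * d s t) = 0"
      using assms[of s] by (cases "s \<in> set_pmf p") (simp_all add: set_pmf_iff)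
  qed
qed auto

text \<open>The compensation identity, with the output law of the whole source as reference, adds a
  nonnegative term to the left side; the inputs outside \<open>A\<close> then add further
  nonnegative terms.\<close>

lemma channel_information_cond_pmf_le:
  assumes b: "1 < b"
  shows "Q * channel_information b (cond_pmf p A) W \<le> channel_information b p W"
proof -
  let ?c = "cond_pmf p A" and ?r = "bind_pmf p W"
  have "set_pmf ?c \<subseteq> set_pmf p"
    by (auto simp: set_pmf_iff pmf_cond_eq split: if_splits)
  then have ac: "set_pmf (bind_pmf ?c W) \<subseteq> set_pmf ?r" by auto
  have "Q * channel_information b ?c W \<le>
      Q * (channel_information b ?c W + relative_entropy b (bind_pmf ?c W) ?r)"
    using relative_entropy_nonneg[OF b ac] Q_pos by simp
  also have "\<dots> = (\<Sum>s\<in>A. pmf p s * relative_entropy b (W s) ?r)"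
    by (simp add: sum_relative_entropy_eq[OF b ac, symmetric] sum_cond_pmf)
  also have "\<dots> \<le> (\<Sum>s\<in>UNIV. pmf p s * relative_entropy b (W s) ?r)"
  proof (rule sum_mono2)
    fix s show "0 \<le> pmf p s * relative_entropy b (W s) ?r"
    proof (cases "s \<in> set_pmf p")
      case True
      then show ?thesis
        using b by (intro mult_nonneg_nonneg relative_entropy_nonneg) auto
    qed (simp add: set_pmf_iff)
  qed auto
  finally show ?thesis
    by (simp add: channel_information_eq_sum[OF b])
qed

text \<open>Emitting the output law of the channel on \<^term>\<open>A\<close> for every other input leaves that law unchanged,
  so these inputs contribute no information.\<close>
definition extend_channel :: "('s \<Rightarrow> 's pmf) \<Rightarrow> 's \<Rightarrow> 's pmf" where
  "extend_channel W s = (if s \<in> A then W s else bind_pmf (cond_pmf p A) W)"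

text \<open>With \<open>?r\<close> the output law on \<open>A\<close>, the inputs in
  \<open>A\<close> contribute \<open>Q\<close> times \<open>?r\<close> and all others
  \<open>1 - Q\<close> times \<open>?r\<close>.\<close>

lemma bind_extend_channel: "bind_pmf p (extend_channel W) = bind_pmf (cond_pmf p A) W"
proof (rule pmf_eqI)
  fix t
  let ?r = "bind_pmf (cond_pmf p A) W"
  have Q: "(\<Sum>s\<in>A. pmf p s) = Q"
    unfolding Q_def by (simp add: measure_measure_pmf_finite)
  have split: "(\<Sum>s\<in>UNIV. f s) = (\<Sum>s\<in>A. f s) + (\<Sum>s\<in>-A. f s)" for f :: "'s \<Rightarrow> real"
    by (subst sum.union_disjoint[symmetric]) (auto simp: Compl_partition)
  have Q': "(\<Sum>s\<in>-A. pmf p s) = 1 - Q"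
    using split[of "pmf p"] by (simp add: Q sum_pmf_UNIV)
  have "pmf (bind_pmf p (extend_channel W)) t =
      (\<Sum>s\<in>A. pmf p s * pmf (W s) t) + (\<Sum>s\<in>-A. pmf p s) * pmf ?r t"
    unfolding pmf_bind_finite[of p] split by (simp add: extend_channel_def sum_distrib_right)
  also have "(\<Sum>s\<in>A. pmf p s * pmf (W s) t) = Q * pmf ?r t"
    unfolding pmf_bind_finite sum_cond_pmf ..
  finally show "pmf (bind_pmf p (extend_channel W)) t = pmf ?r t"
    by (simp add: Q' algebra_simps)
qed

text \<open>Both channels share one output law. Inputs outside \<open>A\<close> emit that law and
  have zero divergence from it; those in \<open>A\<close> match term by term.\<close>

lemma channel_information_extend_channel:
  assumes b: "1 < b"
  shows "channel_information b p (extend_channel W) = Q * channel_information b (cond_pmf p A) W"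
  unfolding channel_information_eq_sum[OF b] bind_extend_channel sum_cond_pmf
  by (rule sum.mono_neutral_cong_right) (auto simp: extend_channel_def)

lemma expected_distortion_extend_channel:
  "expected_distortion d (cond_pmf p A) (extend_channel W) = expected_distortion d (cond_pmf p A) W"
  unfolding expected_distortion_eq_sum
  by (rule sum.cong) (auto simp: extend_channel_def pmf_cond_eq)

text \<open>The law emitted outside \<open>A\<close> mixes only rows in \<open>A\<close>, so it too
  is supported on \<open>Sh\<close>.\<close>

lemma extend_channel_in_test_channels:
  assumes "W \<in> test_channels A Sh"
  shows "extend_channel W \<in> test_channels S Sh"
proof -
  have "set_pmf (cond_pmf p A) \<subseteq> A"
    by (auto simp: set_pmf_iff pmf_cond_eq split: if_splits)
  then show ?thesis
    using assms by (fastforce simp: test_channels_def extend_channel_def)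
qed

text \<open>Restriction never increases the information beyond the factor \<open>Q\<close>, and
  extension attains equality, so a minimizer on \<open>A\<close> extends to one on
  \<open>S\<close>.\<close>

lemma rate_function_cond_pmf:
  assumes b: "1 < b" and sub: "A \<subseteq> S"
    and free: "\<And>s t. s \<in> set_pmf p \<Longrightarrow> s \<notin> A \<Longrightarrow> d s t = 0"
  shows "rate_function b S Sh p d D = ereal Q * rate_function b A Sh (cond_pmf p A) d (D / Q)"
proof -
  let ?F = "feasible_channels S Sh p d D"
  let ?G = "feasible_channels A Sh (cond_pmf p A) d (D / Q)"
  \<comment> \<open>Only inputs in \<open>A\<close> incur distortion, with total weight
    \<open>Q\<close>; hence the budget \<open>D / Q\<close>.\<close>
  have le: "expected_distortion d p W \<le> D \<longleftrightarrow> expected_distortion d (cond_pmf p A) W \<le> D / Q" for W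
    using Q_pos by (simp add: expected_distortion_cond_pmf[OF free] pos_le_divide_eq mult.commute)
  have restrict: "W \<in> ?G" if "W \<in> ?F" for W
    using that sub by (auto simp: feasible_channels_def test_channels_def le)
  have extend: "extend_channel W \<in> ?F" if "W \<in> ?G" for W
    using that by (simp add: feasible_channels_def le expected_distortion_extend_channel
        extend_channel_in_test_channels)
  show ?thesis
  proof (cases "?G = {}")
    case True
    \<comment> \<open>Both rates are infinite here, and the positive factor \<open>Q\<close>
      preserves infinity.\<close>
    then have "?F = {}" using restrict by blast
    with True Q_pos show ?thesis by (simp add: rate_function_def)
  next
    case False
    then obtain W where W: "W \<in> ?G"
      and min: "\<And>V. V \<in> ?G \<Longrightarrow>
        channel_information b (cond_pmf p A) W \<le> channel_information b (cond_pmf p A) V"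
      using exists_information_minimizer[OF b] by blast
    let ?m = "channel_information b (cond_pmf p A) W"
    have "rate_function b S Sh p d D = ereal (Q * ?m)"
    proof (rule rate_function_eqI)
      show "extend_channel W \<in> ?F" using W by (rule extend)
      show "channel_information b p (extend_channel W) = Q * ?m"
        by (rule channel_information_extend_channel[OF b])
      fix V assume "V \<in> ?F"
      then have "Q * ?m \<le> Q * channel_information b (cond_pmf p A) V"
        using min[OF restrict] Q_pos by simp
      also have "\<dots> \<le> channel_information b p V"
        by (rule channel_information_cond_pmf_le[OF b])
      finally show "Q * ?m \<le> channel_information b p V" .
    qed
    moreover have "rate_function b A Sh (cond_pmf p A) d (D / Q) = ereal ?m"
      by (rule rate_function_eqI[OF W min]) auto
    ultimately show ?thesis by simp
  qed
qed

end

section \<open>Vanishing distortion: zero rate and redundant inputs\<close>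

text \<open>A channel emitting one fixed letter is feasible, and its output law equals every row, so
  its information is zero, the least possible value.\<close>

lemma rate_function_eq_0:
  fixes p :: "'s::finite pmf"
  assumes b: "1 < b" and "0 \<le> D" and ne: "Sh \<noteq> {}"
    and free: "\<And>s t. s \<in> set_pmf p \<Longrightarrow> d s t = 0"
  shows "rate_function b S Sh p d D = 0"
proof -
  obtain t where t: "t \<in> Sh" using ne by blast
  let ?W = "\<lambda>_. return_pmf t"
  have "expected_distortion d p ?W = 0"
    unfolding expected_distortion_eq_sum using free by (intro sum.neutral) (auto simp: set_pmf_iff)
  with t \<open>0 \<le> D\<close> have "?W \<in> feasible_channels S Sh p d D"
    by (simp add: feasible_channels_def test_channels_def)
  then have "rate_function b S Sh p d D = ereal 0"
    using channel_information_nonneg[OF b]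
    by (rule rate_function_eqI) (simp add: channel_information_eq_sum[OF b])
  then show ?thesis by (simp add: zero_ereal_def)
qed

context finite_step_closure
begin

lemma funpow_T_monotone: "B \<subseteq> B' \<Longrightarrow> (T ^^ n) B \<subseteq> (T ^^ n) B'"
  by (induction n) (auto dest: T_monotone)

lemma funpow_T_extensive: "B \<subseteq> (T ^^ n) B"
  by (induction n) (use T_extensive in auto)

text \<open>A statement outside the core is recovered from the others within \<open>\<delta>\<close>
  steps, and by monotonicity still is after any letter is added.\<close>

lemma closure_distortion_eq_0:
  assumes "s \<in> S" and "s \<notin> core T S \<delta>"
  shows "closure_distortion T S \<delta> s t = 0"
proof -
  have "S \<subseteq> insert s (S - {s})" by blast
  also have "\<dots> \<subseteq> (T ^^ \<delta>) (S - {s})"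
    using assms funpow_T_extensive[of "S - {s}" \<delta>] unfolding core_def by blast
  also have "\<dots> \<subseteq> (T ^^ \<delta>) ((S - {s}) \<union> {t})"
    by (intro funpow_T_monotone) blast
  finally show ?thesis by (simp add: closure_distortion_def)
qed

end

text \<open>Without closure steps, only \<open>s\<close> itself can make up for the removal of
  \<open>s\<close>.\<close>

lemma closure_distortion_zero_steps:
  "s \<in> S \<Longrightarrow> closure_distortion T S 0 s t = hamming_distortion s t"
  by (auto simp: closure_distortion_def hamming_distortion_def)

theorem mainTheorem7:
  fixes derives :: "'s::finite set \<Rightarrow> 's \<Rightarrow> bool"
    and T :: "'s set \<Rightarrow> 's set"
    and S Sh :: "'s set"
    and P :: "'s pmf"
    and b :: real
  assumes "deductive_source derives T S Sh P"
    and "1 < b"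
  shows "(\<forall>(\<delta>::nat) (D::real). 0 \<le> D \<longrightarrow>
            R_sem b T S Sh P D \<delta> =
              (if core_prob T S P \<delta> = 0 then 0
               else ereal (core_prob T S P \<delta>) * R_core b T S Sh P (D / core_prob T S P \<delta>) \<delta>))
       \<and> core T S 0 = S
       \<and> (\<forall>s\<in>S. \<forall>t\<in>Sh. closure_distortion T S 0 s t = hamming_distortion s t)
       \<and> (\<forall>D::real. 0 \<le> D \<longrightarrow>
            R_sem b T S Sh P D 0 = rate_function b S Sh P hamming_distortion D)"
proof (intro conjI allI impI ballI)
  interpret deductive_source derives T S Sh P by fact
  note b = \<open>1 < b\<close>
  show "R_sem b T S Sh P D \<delta> = (if core_prob T S P \<delta> = 0 then 0
    else ereal (core_prob T S P \<delta>) * R_core b T S Sh P (D / core_prob T S P \<delta>) \<delta>)"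
    if "0 \<le> D" for \<delta> :: nat and D :: real
  proof -
    have free: "closure_distortion T S \<delta> s t = 0" if "s \<in> set_pmf P" "s \<notin> core T S \<delta>" for s t
      using that P_supported by (intro closure_distortion_eq_0) auto
    show ?thesis
    proof (cases "core_prob T S P \<delta> = 0")
      case True
      \<comment> \<open>A null core misses the support, so every input of positive probability is
        free of distortion.\<close>
      then have "set_pmf P \<inter> core T S \<delta> = {}"
        by (simp add: core_prob_def measure_pmf_zero_iff)
      with free have "closure_distortion T S \<delta> s t = 0" if "s \<in> set_pmf P" for s t
        using that by blast
      then show ?thesis
        using True b \<open>0 \<le> D\<close> Sh_nonempty by (simp add: R_sem_def rate_function_eq_0)
    next
      case False
      then have "0 < measure_pmf.prob P (core T S \<delta>)"
        by (simp add: core_prob_def zero_less_measure_iff)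
      then have "rate_function b S Sh P (closure_distortion T S \<delta>) D =
          ereal (core_prob T S P \<delta>) * rate_function b (core T S \<delta>) Sh (cond_pmf P (core T S \<delta>))
            (closure_distortion T S \<delta>) (D / core_prob T S P \<delta>)"
        unfolding core_prob_def
        by (rule rate_function_cond_pmf) (use b free in \<open>auto simp: core_def\<close>)
      with False show ?thesis
        by (simp add: R_sem_def R_core_def core_pmf_def)
    qed
  qed
  show "core T S 0 = S"
    by (auto simp: core_def)
  show "closure_distortion T S 0 s t = hamming_distortion s t" if "s \<in> S" "t \<in> Sh" for s t
    using that by (simp add: closure_distortion_zero_steps)
  show "R_sem b T S Sh P D 0 = rate_function b S Sh P hamming_distortion D" if "0 \<le> D" for D
    unfolding R_sem_def
    by (rule rate_function_cong) (use P_supported in \<open>auto simp: closure_distortion_zero_steps\<close>)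
qed

end
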